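(* Let $A:[0,+\infty)\to M_{n\times n}(\mathbb{R})$ and $C:[0,+\infty)\to M_{m\times n}(\mathbb{R})$ be measurable and bounded on finite intervals, and assume that the system $\dot x(t)=A(t)x(t)$ admits nonuniform bounded growth on $[0,+\infty)$. Then the system $$\dot x(t)=A(t)x(t),\qquad y(t)=C(t)x(t)$$ is nonuniformly completely observable if and only if the control system $$\dot x(t)=-A^T(t)x(t)+C^T(t)u(t),\qquad x(t)\in\mathbb{R}^n,\ u(t)\in\mathbb{R}^m,$$ is nonuniformly completely controllable. In other words, $(A,C)$ is NUCO if and only if $(-A^T,C^T)$ is NUCC.
   Context: Vectors carry the Euclidean norm and $\|\cdot\|$ on matrices is the induced operator norm. For symmetric matrices, $M\le N$ means $N-M$ is positive semidefinite; $I$ is the identity matrix. For a measurable, locally bounded $A:[0,+\infty)\to M_{n\times n}(\mathbb{R})$, $\Phi_A(t,s)$ ($t,s\ge 0$) denotes the transition matrix of $\dot x(t)=A(t)x(t)$ (solutions satisfy $x(t)=\Phi_A(t,s)x(s)$). Nonuniform bounded growth: the system $\dot x=A(t)x$ admits nonuniform bounded growth on $[0,+\infty)$ if there exist constants $K_0>0$, $a>0$, $\varepsilon>0$ such that $$\|\Phi_A(t,\tau)\|\le K_0e^{\varepsilon\tau}e^{a|t-\tau|}\quad\text{for all } t,\tau\ge 0 .$$ Nonuniform complete observability (NUCO): for a pair $(A,C)$, i.e. the system $\dot x=A(t)x$, $y=C(t)x$, let $$M(t_0,t_f)=\int_{t_0}^{t_f}\Phi_A^T(s,t_0)C^T(s)C(s)\Phi_A(s,t_0)\,ds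 .$$ The pair $(A,C)$ is nonuniformly completely observable if there exist fixed numbers $\nu_0\ge 0$, $\nu_1\ge 0$ and functions $\vartheta_0,\vartheta_1:[0,+\infty)\to(0,+\infty)$ such that for any $t\ge 0$ there exists $\sigma_0(t)>0$ with $$\vartheta_0(\sigma)e^{-2\nu_0t}I\le M(t,t+\sigma)\le \vartheta_1(\sigma)e^{2\nu_1t}I\quad\text{for every }\sigma\ge\sigma_0(t).$$ Nonuniform complete controllability (NUCC): for a pair $(A,B)$, i.e. the control system $\dot x=A(t)x+B(t)u$ with $A(t)\in M_{n\times n}(\mathbb{R})$, $B(t)\in M_{n\times p}(\mathbb{R})$ measurable and bounded on finite intervals, let $$W(t_0,t_1)=\int_{t_0}^{t_1}\Phi_A(t_0,s)B(s)B^T(s)\Phi_A^T(t_0,s)\,ds,$$ $$K(t,t+\sigma)=\Phi_A(t+\sigma,t)W(t,t+\sigma)\Phi_A^T(t+\sigma,t).$$ The pair $(A,B)$ is nonuniformly completely controllable if there exist fixed numbers $\mu_0,\mu_1,\tilde\mu_0,\tilde\mu_1\ge 0$ and functions $\alpha_0,\beta_0,\alpha_1,\beta_1:[0,+\infty)\to(0,+\infty)$ such that for any $t\ge 0$ there exists $\sigma_0(t)>0$ with $$e^{-2\mu_0t}\alpha_0(\sigma)I\le W(t,t+\sigma)\le e^{2\mu_1t}\alpha_1(\sigma)I,$$ $$e^{-2\tilde\mu_0t}\beta_0(\sigma)I\le K(t,t+\sigma)\le e^{2\tilde\mu_1t}\beta_1(\sigma)I$$ for every $\sigma\ge\sigma_0(t)$.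 *)

theory Defs
  imports "HOL-Analysis.Analysis"
begin

text \<open>
  Functions on \<open>[0,\<infinity>)\<close> are modelled as functions on all reals; their values at negative arguments
  never matter. An \<open>m\<times>n\<close> matrix has type \<open>real^'n^'m\<close>. The library norm on this type is not the
  operator norm, which is \<^const>\<open>onorm\<close> of the associated linear map; likewise, the library order on
  it is not the positive semidefinite order.
\<close>

text \<open>
  Measurability is Lebesgue measurability. Boundedness does not depend on the choice of the norm.
\<close>

definition measurable_locally_bounded :: "(real \<Rightarrow> real^'n^'m) \<Rightarrow> bool" where
  "measurable_locally_bounded A \<longleftrightarrow>
     A \<in> borel_measurable (lebesgue_on {0..}) \<and> (\<forall>T\<ge>0. bounded (A ` {0..T}))"

definition positive_semidefinite :: "real^'n^'n \<Rightarrow> bool" where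
  "positive_semidefinite P \<longleftrightarrow> transpose P = P \<and> (\<forall>x. 0 \<le> x \<bullet> (P *v x))"

definition psd_le :: "real^'n^'n \<Rightarrow> real^'n^'n \<Rightarrow> bool" (infix "\<preceq>" 50) where
  "M \<preceq> N \<longleftrightarrow> positive_semidefinite (N - M)"

text \<open>
  As \<open>A\<close> is merely measurable, solutions of \<open>x' = A(t) x\<close> are understood in the sense of Caratheodory
  (locally absolutely continuous, satisfying the equation almost everywhere), written in integrated
  form.
\<close>

definition linear_ode_solution :: "(real \<Rightarrow> real^'n^'n) \<Rightarrow> (real \<Rightarrow> real^'n) \<Rightarrow> bool" where
  "linear_ode_solution A x \<longleftrightarrow>
     (\<forall>s t. 0 \<le> s \<and> s \<le> t \<longrightarrow>
        (\<lambda>r. A r *v x r) absolutely_integrable_on {s..t} \<and>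
        x t = x s + integral {s..t} (\<lambda>r. A r *v x r))"

text \<open>
  The description is well defined for measurable locally bounded \<open>A\<close> and \<open>s, t \<ge> 0\<close>, in either order
  of \<open>s\<close> and \<open>t\<close>: every initial value at \<open>s\<close> then belongs to exactly one solution on \<open>[0,\<infinity>)\<close>.
\<close>

definition transition_matrix :: "(real \<Rightarrow> real^'n^'n) \<Rightarrow> real \<Rightarrow> real \<Rightarrow> real^'n^'n" where
  "transition_matrix A t s = (THE P. \<forall>x. linear_ode_solution A x \<longrightarrow> x t = P *v x s)"

definition nonuniform_bounded_growth :: "(real \<Rightarrow> real^'n^'n) \<Rightarrow> bool" where
  "nonuniform_bounded_growth A \<longleftrightarrow>
     (\<exists>K\<^sub>0>0. \<exists>a>0. \<exists>\<epsilon>>0. \<forall>t\<ge>0. \<forall>\<tau>\<ge>0.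
        onorm (\<lambda>x. transition_matrix A t \<tau> *v x) \<le> K\<^sub>0 * exp (\<epsilon> * \<tau>) * exp (a * \<bar>t - \<tau>\<bar>))"

text \<open>
  The Gramians below are only used with the lower limit at most the upper limit. Their integrands are
  bounded and measurable there, so the gauge integral is the Lebesgue integral.
\<close>

definition observability_gramian ::
    "(real \<Rightarrow> real^'n^'n) \<Rightarrow> (real \<Rightarrow> real^'n^'m) \<Rightarrow> real \<Rightarrow> real \<Rightarrow> real^'n^'n" where
  "observability_gramian A C t\<^sub>0 t\<^sub>f =
     integral {t\<^sub>0..t\<^sub>f} (\<lambda>s. transpose (transition_matrix A s t\<^sub>0) ** transpose (C s)
                            ** C s ** transition_matrix A s t\<^sub>0)"

definition NUCO :: "(real \<Rightarrow> real^'n^'n) \<Rightarrow> (real \<Rightarrow> real^'n^'m) \<Rightarrow> bool" where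
  "NUCO A C \<longleftrightarrow>
     (\<exists>\<nu>\<^sub>0\<ge>0. \<exists>\<nu>\<^sub>1\<ge>0. \<exists>\<theta>\<^sub>0 \<theta>\<^sub>1 :: real \<Rightarrow> real.
        (\<forall>\<sigma>\<ge>0. \<theta>\<^sub>0 \<sigma> > 0 \<and> \<theta>\<^sub>1 \<sigma> > 0) \<and>
        (\<forall>t\<ge>0. \<exists>\<sigma>\<^sub>0>0. \<forall>\<sigma>\<ge>\<sigma>\<^sub>0.
           (\<theta>\<^sub>0 \<sigma> * exp (- 2 * \<nu>\<^sub>0 * t)) *\<^sub>R mat 1 \<preceq> observability_gramian A C t (t + \<sigma>) \<and>
           observability_gramian A C t (t + \<sigma>) \<preceq> (\<theta>\<^sub>1 \<sigma> * exp (2 * \<nu>\<^sub>1 * t)) *\<^sub>R mat 1))"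

definition controllability_gramian ::
    "(real \<Rightarrow> real^'n^'n) \<Rightarrow> (real \<Rightarrow> real^'p^'n) \<Rightarrow> real \<Rightarrow> real \<Rightarrow> real^'n^'n" where
  "controllability_gramian A B t\<^sub>0 t\<^sub>1 =
     integral {t\<^sub>0..t\<^sub>1} (\<lambda>s. transition_matrix A t\<^sub>0 s ** B s
                            ** transpose (B s) ** transpose (transition_matrix A t\<^sub>0 s))"

definition transported_gramian ::
    "(real \<Rightarrow> real^'n^'n) \<Rightarrow> (real \<Rightarrow> real^'p^'n) \<Rightarrow> real \<Rightarrow> real \<Rightarrow> real^'n^'n" where
  "transported_gramian A B t\<^sub>0 t\<^sub>1 =
     transition_matrix A t\<^sub>1 t\<^sub>0 ** controllability_gramian A B t\<^sub>0 t\<^sub>1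
       ** transpose (transition_matrix A t\<^sub>1 t\<^sub>0)"

definition NUCC :: "(real \<Rightarrow> real^'n^'n) \<Rightarrow> (real \<Rightarrow> real^'p^'n) \<Rightarrow> bool" where
  "NUCC A B \<longleftrightarrow>
     (\<exists>\<mu>\<^sub>0\<ge>0. \<exists>\<mu>\<^sub>1\<ge>0. \<exists>\<mu>'\<^sub>0\<ge>0. \<exists>\<mu>'\<^sub>1\<ge>0. \<exists>\<alpha>\<^sub>0 \<beta>\<^sub>0 \<alpha>\<^sub>1 \<beta>\<^sub>1 :: real \<Rightarrow> real.
        (\<forall>\<sigma>\<ge>0. \<alpha>\<^sub>0 \<sigma> > 0 \<and> \<beta>\<^sub>0 \<sigma> > 0 \<and> \<alpha>\<^sub>1 \<sigma> > 0 \<and> \<beta>\<^sub>1 \<sigma> > 0) \<and>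
        (\<forall>t\<ge>0. \<exists>\<sigma>\<^sub>0>0. \<forall>\<sigma>\<ge>\<sigma>\<^sub>0.
           (exp (- 2 * \<mu>\<^sub>0 * t) * \<alpha>\<^sub>0 \<sigma>) *\<^sub>R mat 1 \<preceq> controllability_gramian A B t (t + \<sigma>) \<and>
           controllability_gramian A B t (t + \<sigma>) \<preceq> (exp (2 * \<mu>\<^sub>1 * t) * \<alpha>\<^sub>1 \<sigma>) *\<^sub>R mat 1 \<and>
           (exp (- 2 * \<mu>'\<^sub>0 * t) * \<beta>\<^sub>0 \<sigma>) *\<^sub>R mat 1 \<preceq> transported_gramian A B t (t + \<sigma>) \<and>
           transported_gramian A B t (t + \<sigma>) \<preceq> (exp (2 * \<mu>'\<^sub>1 * t) * \<beta>\<^sub>1 \<sigma>) *\<^sub>R mat 1))"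

end

theory Submission
  imports Defs
begin

text \<open>
  Duality rests on \<open>\<Psi>(t, s) = transpose (\<Phi>(s, t))\<close>, where \<open>\<Phi>\<close> and \<open>\<Psi>\<close> are the transition matrices of
  \<open>A\<close> and \<open>- transpose A\<close>: it makes the controllability Gramian \<open>W\<close> of the dual pair equal to the
  observability Gramian \<open>M\<close>, so the bounds on \<open>W\<close> are exactly those on \<open>M\<close>. Moreover
  \<open>K(t, t + \<sigma>)\<close> is the congruence of \<open>M(t, t + \<sigma>)\<close> by \<open>\<Phi>(t, t + \<sigma>)\<close>, and bounded growth
  controls both this matrix and its inverse \<open>\<Phi>(t + \<sigma>, t)\<close>, at the price of a factor
  \<open>exp (2 \<epsilon> t)\<close> and a function of \<open>\<sigma>\<close>; hence the bounds on \<open>K\<close> come for free.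
\<close>

section \<open>Existence of Caratheodory solutions by the Picard series\<close>

text \<open>
  The solution is the Picard (Peano-Baker) series; dominated convergence justifies passing to the
  limit under the integral, as \<open>A\<close> is merely measurable.
\<close>

lemma linear_ode_exists:
  fixes h :: "'a::euclidean_space \<Rightarrow> 'b::euclidean_space \<Rightarrow> 'b" and A :: "real \<Rightarrow> 'a"
  assumes h: "bilinear h" and meas: "A \<in> borel_measurable (lebesgue_on {0..})"
    and bdd: "\<And>T. T \<ge> 0 \<Longrightarrow> bounded (A ` {0..T})"
  obtains x where "x 0 = v"
    and "\<forall>s t. 0 \<le> s \<and> s \<le> t \<longrightarrow> (\<lambda>r. h (A r) (x r)) absolutely_integrable_on {s..t} \<and>
      x t = x s + integral {s..t} (\<lambda>r. h (A r) (x r))"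
proof -
  \<comment> \<open>A bounded measurable factor times a continuous one is absolutely integrable;
    this covers every integrand built from a term of the series.\<close>
  have prod: "(\<lambda>r. h (A r) (y r)) absolutely_integrable_on {0..t}"
    if "continuous_on {0..t} y" "0 \<le> t" for y t
  proof (rule absolutely_integrable_bounded_measurable_product[OF h])
    show "A \<in> borel_measurable (lebesgue_on {0..t})"
      by (rule measurable_restrict_mono[OF meas]) auto
    show "bounded (A ` {0..t})" using bdd that by blast
    show "y absolutely_integrable_on {0..t}"
      using that absolutely_integrable_continuous_real by blast
  qed auto
  interpret h: bounded_bilinear h
    using h by (simp add: bilinear_conv_bounded_bilinear)
  obtain B where B: "B > 0" "\<And>a b. norm (h a b) \<le> norm a * norm b * B"
    using h.pos_bounded by blast
  \<comment> \<open>\<open>D k\<close> is the \<open>k\<close>-th term of the series: the constant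
    initial value integrated \<open>k\<close> times against \<open>A\<close>. The partial sums are
    the Picard iterates.\<close>
  define D where "D = rec_nat (\<lambda>t. v) (\<lambda>k d t. integral {0..t} (\<lambda>r. h (A r) (d r)))"
  have D0: "D 0 t = v" and DS: "D (Suc k) t = integral {0..t} (\<lambda>r. h (A r) (D k r))" for k t
    by (simp_all add: D_def)
  have D_cont: "continuous_on {0..T} (D k)" if "T \<ge> 0" for k T
  proof (induction k)
    case 0
    show ?case unfolding D_def by simp
  next
    case (Suc k)
    have "(\<lambda>r. h (A r) (D k r)) integrable_on {0..T}"
      using prod[OF Suc that] absolutely_integrable_on_def by blast
    from indefinite_integral_continuous_1[OF this] show ?case
      unfolding DS by simp
  qed
  have D_int: "(\<lambda>r. h (A r) (D k r)) absolutely_integrable_on {0..t}" if "t \<ge> 0" for k t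
    using prod[OF D_cont[OF that] that] .
  have hL: "\<exists>L>0. \<forall>r\<in>{0..T}. \<forall>y. norm (h (A r) y) \<le> L * norm y" if T: "T \<ge> 0" for T
  proof -
    obtain a where a: "a > 0" "\<forall>r\<in>{0..T}. norm (A r) \<le> a"
      using bdd[OF T] unfolding bounded_pos by auto
    have "norm (h (A r) y) \<le> (a * B) * norm y" if "r \<in> {0..T}" for r y
    proof -
      have "norm (h (A r) y) \<le> norm (A r) * norm y * B" by (rule B)
      also have "\<dots> \<le> a * norm y * B" using a that B by (intro mult_right_mono) auto
      finally show ?thesis by (simp add: mult_ac)
    qed
    then show ?thesis using a B by (intro exI[of _ "a * B"]) auto
  qed
  have D_bound: "norm (D k t) \<le> norm v * ((L * t) ^ k / fact k)"
    if L: "\<forall>r\<in>{0..T}. \<forall>y. norm (h (A r) y) \<le> L * norm y" "L > 0" and t: "t \<in> {0..T}"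
    for k t L T
    using t
  proof (induction k arbitrary: t)
    case 0
    then show ?case by (simp add: D0)
  next
    case (Suc k)
    \<comment> \<open>The claimed bound at \<open>Suc k\<close> is the antiderivative, vanishing at
      0, of \<open>L\<close> times the bound at \<open>k\<close>, so the induction step is one
      integration.\<close>
    let ?F = "\<lambda>r. norm v * ((L * r) ^ Suc k / fact (Suc k))"
    have I: "((\<lambda>r. L * (norm v * ((L * r) ^ k / fact k))) has_integral (?F t - ?F 0)) {0..t}"
    proof (rule fundamental_theorem_of_calculus)
      show "0 \<le> t" using Suc by auto
      fix r assume "r \<in> {0..t}"
      have "(?F has_real_derivative norm v * ((real (Suc k) * (L * r) ^ k * L) / fact (Suc k))) (at r within {0..t})"
        by (rule derivative_eq_intros refl | simp)+
      also have "norm v * ((real (Suc k) * (L * r) ^ k * L) / fact (Suc k)) = L * (norm v * ((L * r) ^ k / fact k))"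
        by (simp add: field_simps del: of_nat_Suc)
      finally show "(?F has_vector_derivative L * (norm v * ((L * r) ^ k / fact k))) (at r within {0..t})"
        by (simp add: has_real_derivative_iff_has_vector_derivative)
    qed
    have "norm (D (Suc k) t) \<le> integral {0..t} (\<lambda>r. L * (norm v * ((L * r) ^ k / fact k)))"
      unfolding DS
    proof (rule integral_norm_bound_integral)
      show "(\<lambda>r. h (A r) (D k r)) integrable_on {0..t}"
        using D_int[of t k] Suc.prems absolutely_integrable_on_def by auto
      show "(\<lambda>r. L * (norm v * ((L * r) ^ k / fact k))) integrable_on {0..t}"
        using I by blast
      fix r assume r: "r \<in> {0..t}"
      then have rT: "r \<in> {0..T}" using Suc.prems by auto
      have "norm (h (A r) (D k r)) \<le> L * norm (D k r)" using L rT by blast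
      also have "\<dots> \<le> L * (norm v * ((L * r) ^ k / fact k))"
        using Suc.IH[OF rT] L by (intro mult_left_mono) auto
      finally show "norm (h (A r) (D k r)) \<le> L * (norm v * ((L * r) ^ k / fact k))" .
    qed
    also have "\<dots> = ?F t" using integral_unique[OF I] by simp
    finally show ?case .
  qed
  define x where "x t = (\<Sum>k. D k t)" for t
  have exp_summable: "summable (\<lambda>k. norm v * (c ^ k / fact k))" for c :: real
    using summable_exp[of c] by (intro summable_mult) (simp add: field_simps)
  have lim: "(\<lambda>N. \<Sum>k<N. D k t) \<longlonglongrightarrow> x t" if "t \<ge> 0" for t
  proof -
    obtain L where L: "L > 0" "\<forall>r\<in>{0..t}. \<forall>y. norm (h (A r) y) \<le> L * norm y" using hL \<open>t \<ge> 0\<close> by blast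
    have "summable (\<lambda>k. D k t)"
      by (rule summable_comparison_test'[OF exp_summable[of "L * t"], of 0])
        (use D_bound[OF L(2,1)] that in auto)
    then show ?thesis unfolding x_def by (rule summable_LIMSEQ)
  qed
  have main: "(\<lambda>r. h (A r) (x r)) absolutely_integrable_on {0..t} \<and>
      x t = v + integral {0..t} (\<lambda>r. h (A r) (x r))" if t: "t \<ge> 0" for t
  proof -
    obtain L where L: "L > 0" "\<forall>r\<in>{0..t}. \<forall>y. norm (h (A r) y) \<le> L * norm y" using hL t by blast
    define S where "S N r = (\<Sum>k<N. D k r)" for N r
    have S_eq: "h (A r) (S N r) = (\<Sum>k<N. h (A r) (D k r))" for N r
      unfolding S_def by (rule h.sum_right)
    have S_int: "(\<lambda>r. h (A r) (S N r)) absolutely_integrable_on {0..t}" for N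
      unfolding S_eq using D_int[OF t] by (intro absolutely_integrable_sum) auto
    \<comment> \<open>\<open>M\<close> is \<open>norm v * exp (L * t)\<close>. It bounds all partial
      sums on \<open>{0..t}\<close>, so the constant \<open>L * M\<close> dominates all
      integrands.\<close>
    define M where "M = (\<Sum>k. norm v * ((L * t) ^ k / fact k))"
    have S_norm: "norm (h (A r) (S N r)) \<le> L * M" if r: "r \<in> {0..t}" for N r
    proof -
      have "norm (S N r) \<le> (\<Sum>k<N. norm (D k r))" unfolding S_def by (rule norm_sum)
      also have "\<dots> \<le> (\<Sum>k<N. norm v * ((L * t) ^ k / fact k))"
      proof (rule sum_mono)
        fix k
        have "norm (D k r) \<le> norm v * ((L * r) ^ k / fact k)" using D_bound[OF L(2,1) r] .
        also have "\<dots> \<le> norm v * ((L * t) ^ k / fact k)"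
          using r L by (intro mult_left_mono divide_right_mono power_mono) auto
        finally show "norm (D k r) \<le> norm v * ((L * t) ^ k / fact k)" .
      qed
      also have "\<dots> \<le> M" unfolding M_def
        by (rule sum_le_suminf[OF exp_summable]) (use L t in auto)
      finally have "norm (S N r) \<le> M" .
      then have "L * norm (S N r) \<le> L * M" using L by simp
      then show ?thesis using L r order_trans by blast
    qed
    have h_lim: "(\<lambda>N. h (A r) (S N r)) \<longlonglongrightarrow> h (A r) (x r)" if "r \<in> {0..t}" for r
      using lim[of r] that unfolding S_def by (intro h.tendsto) auto
    have x_norm: "norm (h (A r) (x r)) \<le> L * M" if "r \<in> {0..t}" for r
      by (rule Lim_bounded[OF tendsto_norm[OF h_lim[OF that]], of 0]) (use S_norm that in auto)
    have ac: "(\<lambda>r. h (A r) (x r)) absolutely_integrable_on {0..t}"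
      by (rule dominated_convergence_absolutely_integrable[where f = "\<lambda>N r. h (A r) (S N r)" and h = "\<lambda>r. L * M"])
        (use S_int x_norm h_lim in auto)
    have "(\<lambda>N. integral {0..t} (\<lambda>r. h (A r) (S N r))) \<longlonglongrightarrow> integral {0..t} (\<lambda>r. h (A r) (x r))"
      by (rule dominated_convergence(2)[where h = "\<lambda>r. L * M"])
        (use set_lebesgue_integral_eq_integral(1)[OF S_int] S_norm h_lim in auto)
    then have "(\<lambda>N. v + integral {0..t} (\<lambda>r. h (A r) (S N r))) \<longlonglongrightarrow> v + integral {0..t} (\<lambda>r. h (A r) (x r))"
      by (intro tendsto_intros)
    \<comment> \<open>Integrating the sum of the first \<open>N\<close> terms raises each index by
      one, and the initial value \<open>v\<close> supplies the missing term \<open>D 0\<close>.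
      Hence the limits of both sides give the integral equation for \<open>x\<close>.\<close>
    moreover have "v + integral {0..t} (\<lambda>r. h (A r) (S N r)) = (\<Sum>k<Suc N. D k t)" for N
    proof -
      have "integral {0..t} (\<lambda>r. h (A r) (S N r)) = (\<Sum>k<N. D (Suc k) t)"
        unfolding S_eq DS using set_lebesgue_integral_eq_integral(1)[OF D_int[OF t]] by (intro integral_sum) auto
      then show ?thesis by (subst sum.lessThan_Suc_shift) (simp add: D0)
    qed
    ultimately have "(\<lambda>N. \<Sum>k<Suc N. D k t) \<longlonglongrightarrow> v + integral {0..t} (\<lambda>r. h (A r) (x r))" by simp
    with LIMSEQ_Suc[OF lim[OF t]] have "x t = v + integral {0..t} (\<lambda>r. h (A r) (x r))"
      by (rule LIMSEQ_unique)
    with ac show ?thesis by blast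
  qed
  show ?thesis
  proof (rule that, safe)
    show "x 0 = v" using main[of 0] by simp
    fix s t :: real assume st: "0 \<le> s" "s \<le> t"
    show "(\<lambda>r. h (A r) (x r)) absolutely_integrable_on {s..t}"
      by (rule absolutely_integrable_on_subinterval[where S = "{0..t}"]) (use main[of t] st in auto)
    have "integral {0..s} (\<lambda>r. h (A r) (x r)) + integral {s..t} (\<lambda>r. h (A r) (x r))
        = integral {0..t} (\<lambda>r. h (A r) (x r))"
      by (rule Henstock_Kurzweil_Integration.integral_combine) (use main[of t] st set_lebesgue_integral_eq_integral(1) in auto)
    then show "x t = x s + integral {s..t} (\<lambda>r. h (A r) (x r))"
      using main[of s] main[of t] st by simp
  qed
qed


section \<open>Fundamental matrices and regularity of solutions\<close>

lemma bounded_linear_matrix_vector_mult_left: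
  "bounded_linear (\<lambda>M :: real^'n^'m. M *v v)"
  by (intro linear_conv_bounded_linear[THEN iffD1] linearI)
    (simp_all add: matrix_vector_mult_add_rdistrib scaleR_matrix_vector_assoc)

lemma bilinear_matrix_matrix_mult:
  "bilinear ((**) :: real^'n^'m \<Rightarrow> real^'k^'n \<Rightarrow> real^'k^'m)"
  unfolding bilinear_def
  by (auto intro!: linearI simp: matrix_matrix_mult_def vec_eq_iff algebra_simps sum.distrib sum_distrib_left)

lemma bounded_linear_transpose: "bounded_linear (transpose :: real^'n^'m \<Rightarrow> real^'m^'n)"
  by (intro linear_conv_bounded_linear[THEN iffD1] linearI) (simp_all add: transpose_def vec_eq_iff)

text \<open>Ensures that the existence and regularity results apply to the adjoint system as well.
  Negated transposition is linear and continuous, hence preserves both measurability and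
  boundedness.\<close>

lemma measurable_locally_bounded_neg_transpose:
  fixes A :: "real \<Rightarrow> real^'n^'m"
  assumes "measurable_locally_bounded A"
  shows "measurable_locally_bounded (\<lambda>t. - transpose (A t))"
proof -
  have bl: "bounded_linear (\<lambda>M :: real^'n^'m. - transpose M)"
    by (rule bounded_linear_minus[OF bounded_linear_transpose])
  have "(\<lambda>M :: real^'n^'m. - transpose M) \<in> borel_measurable borel"
    by (rule borel_measurable_continuous_onI[OF linear_continuous_on[OF bl]])
  then have "(\<lambda>t. - transpose (A t)) \<in> borel_measurable (lebesgue_on {0..})"
    by (rule measurable_compose[rotated]) (use assms in \<open>simp add: measurable_locally_bounded_def\<close>)
  moreover have "bounded ((\<lambda>t. - transpose (A t)) ` {0..T})" if "T \<ge> 0" for T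
    using bounded_linear_image[OF _ bl, of "A ` {0..T}"] assms that
    unfolding measurable_locally_bounded_def by (simp add: image_image)
  ultimately show ?thesis unfolding measurable_locally_bounded_def by blast
qed

text \<open>The existence result with the matrix product as bilinear map solves the matrix equation
  \<open>X' = A X\<close>; applying the integrated equation to a fixed vector commutes with the
  integral. All these solutions thus depend linearly on the initial value.\<close>

lemma fundamental_matrix_exists:
  fixes A :: "real \<Rightarrow> real^'n^'n"
  assumes "measurable_locally_bounded A"
  obtains X :: "real \<Rightarrow> real^'n^'n" where "X 0 = mat 1" and "\<And>v. linear_ode_solution A (\<lambda>t. X t *v v)"
proof -
  have meas: "A \<in> borel_measurable (lebesgue_on {0..})"
    and bdd: "\<And>T. T \<ge> 0 \<Longrightarrow> bounded (A ` {0..T})"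
    using assms by (auto simp: measurable_locally_bounded_def)
  obtain X :: "real \<Rightarrow> real^'n^'n" where X0: "X 0 = mat 1"
    and sol: "\<forall>s t. 0 \<le> s \<and> s \<le> t \<longrightarrow> (\<lambda>r. A r ** X r) absolutely_integrable_on {s..t} \<and>
      X t = X s + integral {s..t} (\<lambda>r. A r ** X r)"
    using linear_ode_exists[OF bilinear_matrix_matrix_mult meas bdd, where v = "mat 1"] by blast
  have "linear_ode_solution A (\<lambda>t. X t *v v)" for v
    unfolding linear_ode_solution_def
  proof (intro allI impI conjI)
    fix s t :: real assume st: "0 \<le> s \<and> s \<le> t"
    then have ac: "(\<lambda>r. A r ** X r) absolutely_integrable_on {s..t}"
      and eq: "X t = X s + integral {s..t} (\<lambda>r. A r ** X r)"
      using sol by blast+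
    note bl = bounded_linear_matrix_vector_mult_left[of v]
    have o: "(\<lambda>M. M *v v) \<circ> (\<lambda>r. A r ** X r) = (\<lambda>r. A r *v (X r *v v))"
      by (simp add: o_def matrix_vector_mul_assoc)
    show "(\<lambda>r. A r *v (X r *v v)) absolutely_integrable_on {s..t}"
      using absolutely_integrable_linear[OF ac bl] unfolding o by simp
    have "integral {s..t} (\<lambda>r. A r *v (X r *v v)) = integral {s..t} (\<lambda>r. A r ** X r) *v v"
      using integral_linear[OF set_lebesgue_integral_eq_integral(1)[OF ac] bl] unfolding o by simp
    then show "X t *v v = X s *v v + integral {s..t} (\<lambda>r. A r *v (X r *v v))"
      using eq by (simp add: matrix_vector_mult_add_rdistrib)
  qed
  with X0 show ?thesis using that by blast
qed

lemma measurable_locally_bounded_bound: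
  fixes A :: "real \<Rightarrow> real^'n^'m"
  assumes "measurable_locally_bounded A" "T \<ge> 0"
  obtains L where "L > 0" and "\<And>r (v :: real^'n). r \<in> {0..T} \<Longrightarrow> norm (A r *v v) \<le> L * norm v"
proof -
  have "bilinear ((*v) :: real^'n^'m \<Rightarrow> _)"
    unfolding bilinear_def
    using bounded_linear_matrix_vector_mult_left bounded_linear.linear matrix_vector_mul_linear by blast
  then interpret bounded_bilinear "(*v) :: real^'n^'m \<Rightarrow> _"
    by (simp add: bilinear_conv_bounded_bilinear)
  obtain K where K: "K > 0" "\<And>(M :: real^'n^'m) v. norm (M *v v) \<le> norm M * norm v * K"
    using pos_bounded by blast
  obtain a where a: "a > 0" "\<And>r. r \<in> {0..T} \<Longrightarrow> norm (A r) \<le> a"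
    using assms unfolding measurable_locally_bounded_def bounded_pos by blast
  show ?thesis
  proof (rule that[of "a * K"])
    fix r :: real and v :: "real^'n" assume "r \<in> {0..T}"
    then have "norm (A r) * norm v * K \<le> a * norm v * K"
      using a K by (intro mult_right_mono) auto
    then show "norm (A r *v v) \<le> a * K * norm v"
      using K(2)[of "A r" v] by (simp add: mult_ac)
  qed (use a K in simp)
qed

text \<open>As an indefinite integral the solution is continuous, hence bounded on the compact
  interval. Then the right-hand side is bounded too, and this bound is a Lipschitz constant.\<close>

lemma linear_ode_solution_lipschitz:
  assumes A: "measurable_locally_bounded A" and x: "linear_ode_solution A x" and T: "T \<ge> 0"
  obtains K where "K-lipschitz_on {0..T} x"
proof -
  obtain L where L: "L > 0" "\<And>r v. r \<in> {0..T} \<Longrightarrow> norm (A r *v v) \<le> L * norm v"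
    using measurable_locally_bounded_bound[OF A T] by blast
  have int: "(\<lambda>r. A r *v x r) integrable_on {s..t}"
    and eq: "x t = x s + integral {s..t} (\<lambda>r. A r *v x r)" if "0 \<le> s" "s \<le> t" for s t
    using x that set_lebesgue_integral_eq_integral(1) unfolding linear_ode_solution_def by blast+
  have "continuous_on {0..T} (\<lambda>t. x 0 + integral {0..t} (\<lambda>r. A r *v x r))"
    using int[of 0 T] T by (intro continuous_intros indefinite_integral_continuous_1) auto
  then have "continuous_on {0..T} x"
    by (rule continuous_on_eq) (rule eq[symmetric], auto)
  then have "bounded (x ` {0..T})"
    by (intro compact_imp_bounded compact_continuous_image) auto
  then obtain b where b: "b > 0" "\<And>r. r \<in> {0..T} \<Longrightarrow> norm (x r) \<le> b"
    unfolding bounded_pos by blast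
  have le: "dist (x s) (x t) \<le> L * b * dist s t" if "0 \<le> s" "s \<le> t" "t \<le> T" for s t
  proof -
    have "norm (integral {s..t} (\<lambda>r. A r *v x r)) \<le> (L * b) * measure lborel {s..t}"
    proof (rule has_integral_bound_real[where f = "\<lambda>r. A r *v x r" and S = "{}"])
      show "((\<lambda>r. A r *v x r) has_integral integral {s..t} (\<lambda>r. A r *v x r)) {s..t}"
        using int that by blast
      fix r assume "r \<in> {s..t} - {}"
      then have r: "r \<in> {0..T}" using that by auto
      have "norm (A r *v x r) \<le> L * norm (x r)" by (rule L(2)[OF r])
      also have "\<dots> \<le> L * b" using b(2)[OF r] L by simp
      finally show "norm (A r *v x r) \<le> L * b" .
    qed (use L b in auto)
    then show ?thesis using eq[of s t] that by (simp add: dist_norm norm_minus_commute)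
  qed
  have "(L * b)-lipschitz_on {0..T} x"
  proof (rule lipschitz_onI)
    fix s t assume "s \<in> {0..T}" "t \<in> {0..T}"
    then show "dist (x s) (x t) \<le> L * b * dist s t"
      using le[of s t] le[of t s] by (cases "s \<le> t") (auto simp: dist_commute)
  qed (use L b in auto)
  then show ?thesis using that by blast
qed


section \<open>The invariant pairing of a system with its adjoint\<close>

text \<open>The adjoint identity in the form that arises after the simplifier has turned
  \<open>transpose M *v y\<close> into \<open>y v* M\<close>.\<close>

lemma inner_vector_matrix_mult:
  fixes M :: "real^'n^'m"
  shows "x \<bullet> (y v* M) = (M *v x) \<bullet> y"
  by (metis dot_lmul_matrix inner_commute)

text \<open>Quadratic increments force the derivative to vanish everywhere on the interval.\<close>

lemma constant_if_quadratic_increments: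
  fixes f :: "real \<Rightarrow> real"
  assumes "\<And>s t. 0 \<le> s \<Longrightarrow> s \<le> t \<Longrightarrow> t \<le> T \<Longrightarrow> \<bar>f t - f s\<bar> \<le> c * (t - s)\<^sup>2" and "T \<ge> 0"
  shows "f T = f 0"
proof -
  \<comment> \<open>The maximum with 1 makes the constant positive, so that \<open>e / c'\<close>
    can serve as the radius below.\<close>
  define c' where "c' = max c 1"
  have c': "c' > 0" "c \<le> c'" by (auto simp: c'_def)
  have bound: "\<bar>f t - f s\<bar> \<le> c' * \<bar>t - s\<bar> * \<bar>t - s\<bar>" if "s \<in> {0..T}" "t \<in> {0..T}" for s t
  proof -
    have "\<bar>f t - f s\<bar> \<le> c * (t - s)\<^sup>2"
      using assms(1)[of s t] assms(1)[of t s] that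
      by (cases "s \<le> t") (auto simp: abs_minus_commute power2_commute)
    also have "\<dots> \<le> c' * (t - s)\<^sup>2" using c' by (intro mult_right_mono) auto
    finally show ?thesis by (simp add: power2_eq_square)
  qed
  have "(f has_derivative (\<lambda>_. 0)) (at s within {0..T})" if s: "s \<in> {0..T}" for s
    unfolding has_derivative_within_alt
  proof (intro conjI allI impI)
    fix e :: real assume e: "0 < e"
    have "norm (f t - f s - 0) \<le> e * norm (t - s)"
      if "t \<in> {0..T}" "norm (t - s) < e / c'" for t
    proof -
      have "c' * \<bar>t - s\<bar> \<le> e" using that c' by (simp add: field_simps)
      then have "c' * \<bar>t - s\<bar> * \<bar>t - s\<bar> \<le> e * \<bar>t - s\<bar>" by (rule mult_right_mono) auto
      then show ?thesis using bound[OF s that(1)] by simp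
    qed
    then show "\<exists>d>0. \<forall>t\<in>{0..T}. norm (t - s) < d \<longrightarrow> norm (f t - f s - 0) \<le> e * norm (t - s)"
      using e c' by (intro exI[of _ "e / c'"]) auto
  qed auto
  then obtain k where "\<And>s. s \<in> {0..T} \<Longrightarrow> f s = k"
    using has_derivative_zero_constant[of "{0..T}" f] by auto
  then show ?thesis using \<open>T \<ge> 0\<close> by simp
qed

text \<open>
  Solutions are Lipschitz, so the increments of \<open>y \<bullet> x\<close> are quadratically small: this avoids
  integration by parts for absolutely continuous functions.
\<close>

lemma adjoint_solutions_inner_constant:
  assumes A: "measurable_locally_bounded A" and x: "linear_ode_solution A x"
    and y: "linear_ode_solution (\<lambda>t. - transpose (A t)) y" and T: "T \<ge> 0"
  shows "y T \<bullet> x T = y 0 \<bullet> x 0"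
proof -
  note A' = measurable_locally_bounded_neg_transpose[OF A]
  obtain Kx where Kx: "Kx-lipschitz_on {0..T} x" using linear_ode_solution_lipschitz[OF A x T] .
  obtain Ky where Ky: "Ky-lipschitz_on {0..T} y" using linear_ode_solution_lipschitz[OF A' y T] .
  obtain L where L: "L > 0" "\<And>r v. r \<in> {0..T} \<Longrightarrow> norm (A r *v v) \<le> L * norm v"
    using measurable_locally_bounded_bound[OF A T] by blast
  have "bounded (x ` {0..T})" "bounded (y ` {0..T})"
    using Kx Ky by (auto intro!: compact_imp_bounded compact_continuous_image lipschitz_on_continuous_on)
  then obtain mx my where mx: "mx > 0" "\<And>r. r \<in> {0..T} \<Longrightarrow> norm (x r) \<le> mx"
    and my: "my > 0" "\<And>r. r \<in> {0..T} \<Longrightarrow> norm (y r) \<le> my"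
    unfolding bounded_pos by blast
  \<comment> \<open>The two summands bound the two terms of the integrand below, each divided by
    \<open>t - s\<close>: one uses the Lipschitz constant of \<open>y\<close>, the other that of
    \<open>x\<close>.\<close>
  define c where "c = Ky * (L * mx) + my * (L * Kx)"
  have K0: "Kx \<ge> 0" "Ky \<ge> 0" using Kx Ky lipschitz_on_nonneg by blast+
  show ?thesis
  proof (rule constant_if_quadratic_increments[where f = "\<lambda>t. y t \<bullet> x t" and c = c])
    fix s t :: real assume st: "0 \<le> s" "s \<le> t" "t \<le> T"
    have hx: "((\<lambda>r. A r *v x r) has_integral (x t - x s)) {s..t}"
      using x st set_lebesgue_integral_eq_integral(1) unfolding linear_ode_solution_def
      by (auto simp: has_integral_iff)
    have hy: "((\<lambda>r. - transpose (A r) *v y r) has_integral (y t - y s)) {s..t}"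
      using y st set_lebesgue_integral_eq_integral(1) unfolding linear_ode_solution_def
      by (auto simp: has_integral_iff)
    \<comment> \<open>The increment of the pairing is split as
      \<open>y t \<bullet> (x t - x s) + (y t - y s) \<bullet> x s\<close>, and each difference is
      replaced by the integral of its equation.\<close>
    have "((\<lambda>r. y t \<bullet> (A r *v x r) + (- transpose (A r) *v y r) \<bullet> x s)
        has_integral (y t \<bullet> (x t - x s) + (y t - y s) \<bullet> x s)) {s..t}"
      using has_integral_linear[OF hx bounded_linear_inner_right[of "y t"]]
        has_integral_linear[OF hy bounded_linear_inner_left[of "x s"]]
      by (intro has_integral_add) (simp_all add: o_def)
    moreover have "- M *v v = - (M *v v)" for M :: "real^'a^'a" and v
      by (simp add: vec_eq_iff matrix_vector_mult_def sum_negf)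
    then have "(- transpose (A r) *v y r) \<bullet> x s = - (y r \<bullet> (A r *v x s))" for r
      by (simp add: dot_lmul_matrix transpose_matrix_vector)
    \<comment> \<open>Moving the transpose across the inner product leaves
      \<open>y t \<bullet> (A r *v x r) - y r \<bullet> (A r *v x s)\<close>. Adding and subtracting
      \<open>y r \<bullet> (A r *v x r)\<close> gives two terms of order \<open>t - s\<close>, so
      the integral is of order \<open>(t - s)\<^sup>2\<close>.\<close>
    ultimately have I: "((\<lambda>r. (y t - y r) \<bullet> (A r *v x r) + y r \<bullet> (A r *v (x r - x s)))
        has_integral (y t \<bullet> x t - y s \<bullet> x s)) {s..t}"
      by (simp add: algebra_simps matrix_vector_mult_diff_distrib)
    have "norm (y t \<bullet> x t - y s \<bullet> x s) \<le> (c * (t - s)) * measure lborel {s..t}"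
    proof (rule has_integral_bound_real[OF _ finite.emptyI I])
      show "0 \<le> c * (t - s)" using st K0 L mx my by (simp add: c_def)
      fix r assume "r \<in> {s..t} - {}"
      then have r: "r \<in> {s..t}" by simp
      then have rT: "r \<in> {0..T}" using st by auto
      have yr: "norm (y t - y r) \<le> Ky * (t - s)"
      proof -
        have "norm (y t - y r) \<le> Ky * \<bar>t - r\<bar>"
          using lipschitz_onD[OF Ky, of t r] st rT by (simp add: dist_norm)
        also have "\<dots> \<le> Ky * (t - s)" using r K0 by (intro mult_left_mono) auto
        finally show ?thesis .
      qed
      have xr: "norm (x r - x s) \<le> Kx * (t - s)"
      proof -
        have "norm (x r - x s) \<le> Kx * \<bar>r - s\<bar>"
          using lipschitz_onD[OF Kx, of r s] st rT by (simp add: dist_norm)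
        also have "\<dots> \<le> Kx * (t - s)" using r K0 by (intro mult_left_mono) auto
        finally show ?thesis .
      qed
      have Ax: "norm (A r *v v) \<le> L * b" if "norm v \<le> b" for v b
        using L(2)[OF rT, of v] that L(1) by (meson mult_left_mono less_imp_le order_trans)
      have "\<bar>(y t - y r) \<bullet> (A r *v x r)\<bar> \<le> norm (y t - y r) * norm (A r *v x r)"
        by (rule Cauchy_Schwarz_ineq2)
      also have "\<dots> \<le> (Ky * (t - s)) * (L * mx)"
        using yr Ax[OF mx(2)[OF rT]] K0 st by (intro mult_mono) auto
      finally have 1: "\<bar>(y t - y r) \<bullet> (A r *v x r)\<bar> \<le> (Ky * (t - s)) * (L * mx)" .
      have "\<bar>y r \<bullet> (A r *v (x r - x s))\<bar> \<le> norm (y r) * norm (A r *v (x r - x s))"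
        by (rule Cauchy_Schwarz_ineq2)
      also have "\<dots> \<le> my * (L * (Kx * (t - s)))"
        using my rT Ax[OF xr] by (intro mult_mono) auto
      finally have 2: "\<bar>y r \<bullet> (A r *v (x r - x s))\<bar> \<le> my * (L * (Kx * (t - s)))" .
      show "norm ((y t - y r) \<bullet> (A r *v x r) + y r \<bullet> (A r *v (x r - x s))) \<le> c * (t - s)"
        using 1 2 by (simp add: c_def algebra_simps)
    qed
    then show "\<bar>y t \<bullet> x t - y s \<bullet> x s\<bar> \<le> c * (t - s)\<^sup>2"
      using st by (simp add: power2_eq_square mult_ac)
  qed (rule T)
qed


section \<open>Transition matrices of the system and its adjoint\<close>

text \<open>The first assumption says that \<open>P\<close> fits the description. The second makes
  it the only candidate: solutions take every value at \<open>s\<close>, so two fitting matrices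
  agree on all vectors.\<close>

lemma transition_matrix_eqI:
  assumes "\<And>x. linear_ode_solution A x \<Longrightarrow> x t = P *v x s"
    and "\<And>v. \<exists>x. linear_ode_solution A x \<and> x s = v"
  shows "transition_matrix A t s = P"
  unfolding transition_matrix_def
proof (rule the_equality)
  fix Q assume Q: "\<forall>x. linear_ode_solution A x \<longrightarrow> x t = Q *v x s"
  show "Q = P" unfolding matrix_eq using Q assms by metis
qed (use assms(1) in blast)

text \<open>
  The fundamental matrices \<open>X\<close> of \<open>A\<close> and \<open>Z\<close> of \<open>- transpose A\<close> satisfy \<open>transpose (Z t) ** X t = mat 1\<close>;
  this yields invertibility and uniqueness for both systems at once.
\<close>

lemma transition_matrix_factorization:
  fixes A :: "real \<Rightarrow> real^'n^'n"
  assumes A: "measurable_locally_bounded A"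
  obtains X Z :: "real \<Rightarrow> real^'n^'n" where "\<And>t. t \<ge> 0 \<Longrightarrow> transpose (Z t) ** X t = mat 1"
    and "\<And>s t. s \<ge> 0 \<Longrightarrow> t \<ge> 0 \<Longrightarrow> transition_matrix A t s = X t ** transpose (Z s)"
    and "\<And>s t. s \<ge> 0 \<Longrightarrow> t \<ge> 0 \<Longrightarrow>
      transition_matrix (\<lambda>r. - transpose (A r)) t s = Z t ** transpose (X s)"
proof -
  obtain X where X: "X 0 = mat 1" "\<And>v. linear_ode_solution A (\<lambda>t. X t *v v)"
    using fundamental_matrix_exists[OF A] by blast
  obtain Z where Z: "Z 0 = mat 1" "\<And>v. linear_ode_solution (\<lambda>r. - transpose (A r)) (\<lambda>t. Z t *v v)"
    using fundamental_matrix_exists[OF measurable_locally_bounded_neg_transpose[OF A]] by blast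
  have eqI: "v = w" if "\<And>u :: real^'n. u \<bullet> v = u \<bullet> w" for v w
    using that vector_eq_ldot by blast
  \<comment> \<open>Pairing \<open>x\<close> with the adjoint solution \<open>Z t *v u\<close> for
    every \<open>u\<close> determines \<open>transpose (Z t) *v x t\<close>. So the initial value
    can be recovered from the value at any time, which gives uniqueness.\<close>
  have x: "transpose (Z t) *v x t = x 0" if "linear_ode_solution A x" "t \<ge> 0" for x t
    using adjoint_solutions_inner_constant[OF A that(1) Z(2) that(2)]
    by (intro eqI) (simp add: Z(1) inner_vector_matrix_mult)
  have z: "transpose (X t) *v z t = z 0" if "linear_ode_solution (\<lambda>r. - transpose (A r)) z" "t \<ge> 0" for z t
    using adjoint_solutions_inner_constant[OF A X(2) that]
    by (intro eqI) (simp add: X(1) inner_vector_matrix_mult inner_commute)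
  have ZX: "transpose (Z t) ** X t = mat 1" if "t \<ge> 0" for t
    unfolding matrix_eq using x[OF X(2) that] X(1) by (simp add: matrix_vector_mul_assoc[symmetric] del: transpose_matrix_vector)
  then have XZ: "X t ** transpose (Z t) = mat 1" if "t \<ge> 0" for t
    using that matrix_left_right_inverse by blast
  then have ZX': "Z t ** transpose (X t) = mat 1" if "t \<ge> 0" for t
    using that by (metis matrix_transpose_mul transpose_mat transpose_transpose)
  have 1: "transition_matrix A t s = X t ** transpose (Z s)" if "s \<ge> 0" "t \<ge> 0" for s t
  proof (rule transition_matrix_eqI)
    fix y assume y: "linear_ode_solution A y"
    have "y t = X t *v (transpose (Z t) *v y t)"
      using XZ[OF that(2)] by (simp add: matrix_vector_mul_assoc del: transpose_matrix_vector)
    also have "\<dots> = X t *v (transpose (Z s) *v y s)" using x[OF y] that by (simp del: transpose_matrix_vector)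
    finally show "y t = X t ** transpose (Z s) *v y s" by (simp add: matrix_vector_mul_assoc del: transpose_matrix_vector)
  next
    fix v :: "real^'n"
    \<comment> \<open>The solution through \<open>v\<close> at time \<open>s\<close> is the one
      whose initial value at 0 is \<open>transpose (Z s) *v v\<close>.\<close>
    show "\<exists>y. linear_ode_solution A y \<and> y s = v"
      using X(2)[of "transpose (Z s) *v v"] XZ[OF that(1)] by (force simp: matrix_vector_mul_assoc simp del: transpose_matrix_vector)
  qed
  have 2: "transition_matrix (\<lambda>r. - transpose (A r)) t s = Z t ** transpose (X s)" if "s \<ge> 0" "t \<ge> 0" for s t
  proof (rule transition_matrix_eqI)
    fix y assume y: "linear_ode_solution (\<lambda>r. - transpose (A r)) y"
    have "y t = Z t *v (transpose (X t) *v y t)"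
      using ZX'[OF that(2)] by (simp add: matrix_vector_mul_assoc del: transpose_matrix_vector)
    also have "\<dots> = Z t *v (transpose (X s) *v y s)" using z[OF y] that by (simp del: transpose_matrix_vector)
    finally show "y t = Z t ** transpose (X s) *v y s" by (simp add: matrix_vector_mul_assoc del: transpose_matrix_vector)
  next
    fix v :: "real^'n"
    show "\<exists>y. linear_ode_solution (\<lambda>r. - transpose (A r)) y \<and> y s = v"
      using Z(2)[of "transpose (X s) *v v"] ZX'[OF that(1)] by (force simp: matrix_vector_mul_assoc simp del: transpose_matrix_vector)
  qed
  show ?thesis by (rule that[of Z X]) (fact ZX 1 2)+
qed

text \<open>By the factorization both sides equal \<open>Z t ** transpose (X s)\<close>.\<close>

lemma transition_matrix_neg_transpose:
  assumes "measurable_locally_bounded A" "s \<ge> 0" "t \<ge> 0"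
  shows "transition_matrix (\<lambda>r. - transpose (A r)) t s = transpose (transition_matrix A s t)"
  using transition_matrix_factorization[OF assms(1)] assms(2,3)
  by (metis matrix_transpose_mul transpose_transpose)

lemma transition_matrix_inverse:
  fixes A :: "real \<Rightarrow> real^'n^'n"
  assumes "measurable_locally_bounded A" "s \<ge> 0" "t \<ge> 0"
  shows "transition_matrix A s t ** transition_matrix A t s = mat 1"
proof -
  obtain X Z :: "real \<Rightarrow> real^'n^'n" where XZ: "\<And>t. t \<ge> 0 \<Longrightarrow> transpose (Z t) ** X t = mat 1"
    "\<And>s t. s \<ge> 0 \<Longrightarrow> t \<ge> 0 \<Longrightarrow> transition_matrix A t s = X t ** transpose (Z s)"
    using transition_matrix_factorization[OF assms(1)] by metis
  have "X s ** transpose (Z t) ** (X t ** transpose (Z s)) = X s ** (transpose (Z t) ** X t) ** transpose (Z s)"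
    by (simp add: matrix_mul_assoc)
  also have "\<dots> = mat 1"
    using XZ(1)[of t] XZ(1)[of s] assms matrix_left_right_inverse[of "X s" "transpose (Z s)"] by simp
  finally show ?thesis using XZ(2) assms by simp
qed

section \<open>Duality of the Gramians\<close>

lemma controllability_gramian_dual:
  assumes "measurable_locally_bounded A" "t \<ge> 0"
  shows "controllability_gramian (\<lambda>r. - transpose (A r)) (\<lambda>r. transpose (C r)) t u
    = observability_gramian A C t u"
  unfolding controllability_gramian_def observability_gramian_def
  by (rule integral_cong) (use assms in \<open>simp add: transition_matrix_neg_transpose\<close>)

lemma transported_gramian_dual:
  assumes "measurable_locally_bounded A" "t \<ge> 0" "u \<ge> 0"
  shows "transported_gramian (\<lambda>r. - transpose (A r)) (\<lambda>r. transpose (C r)) t u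
    = transpose (transition_matrix A t u) ** observability_gramian A C t u ** transition_matrix A t u"
  unfolding transported_gramian_def
  using assms by (simp add: transition_matrix_neg_transpose controllability_gramian_dual)

section \<open>Semidefinite bounds under congruence\<close>

lemma transpose_diff: "transpose (M - N) = transpose M - transpose N"
  by (simp add: transpose_def vec_eq_iff)

lemma transpose_scaled_identity: "transpose (c *\<^sub>R mat 1 :: real^'n^'n) = c *\<^sub>R mat 1"
  by (simp add: transpose_def mat_def vec_eq_iff)

text \<open>Subtracting a multiple of the identity does not affect symmetry, so the order becomes
  symmetry of \<open>M\<close> together with a bound on its quadratic form.\<close>

lemma scaled_identity_psd_le_iff:
  "c *\<^sub>R mat 1 \<preceq> M \<longleftrightarrow> transpose M = M \<and> (\<forall>x. c * (norm x)\<^sup>2 \<le> x \<bullet> (M *v x))"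
  unfolding psd_le_def positive_semidefinite_def transpose_diff transpose_scaled_identity
  by (simp add: matrix_vector_mult_diff_rdistrib scaleR_matrix_vector_assoc[symmetric]
      inner_diff_right dot_square_norm)

lemma psd_le_scaled_identity_iff:
  "M \<preceq> c *\<^sub>R mat 1 \<longleftrightarrow> transpose M = M \<and> (\<forall>x. x \<bullet> (M *v x) \<le> c * (norm x)\<^sup>2)"
  unfolding psd_le_def positive_semidefinite_def transpose_diff transpose_scaled_identity
  by (simp add: matrix_vector_mult_diff_rdistrib scaleR_matrix_vector_assoc[symmetric]
      inner_diff_right dot_square_norm)

lemma inner_congruence:
  fixes M :: "real^'n^'n" and P :: "real^'m^'n"
  shows "x \<bullet> ((transpose P ** M ** P) *v x) = (P *v x) \<bullet> (M *v (P *v x))"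
  by (simp add: matrix_vector_mul_assoc[symmetric] inner_vector_matrix_mult)

lemma transpose_congruence:
  fixes M :: "real^'n^'n" and P :: "real^'m^'n"
  shows "transpose M = M \<Longrightarrow> transpose (transpose P ** M ** P) = transpose P ** M ** P"
  by (simp add: matrix_transpose_mul matrix_mul_assoc)

text \<open>The quadratic form of the congruence at \<open>x\<close> is that of \<open>M\<close> at
  \<open>P *v x\<close>, so the lower bounds multiply; \<open>c \<ge> 0\<close> preserves the
  direction of the inequality.\<close>

lemma scaled_identity_psd_le_congruence:
  fixes M :: "real^'n^'n" and P :: "real^'m^'n"
  assumes "c *\<^sub>R mat 1 \<preceq> M" "c \<ge> 0" "\<And>x. b * (norm x)\<^sup>2 \<le> (norm (P *v x))\<^sup>2"
  shows "(c * b) *\<^sub>R mat 1 \<preceq> transpose P ** M ** P"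
proof -
  have "(c * b) * (norm x)\<^sup>2 \<le> (P *v x) \<bullet> (M *v (P *v x))" for x
  proof -
    have "c * (b * (norm x)\<^sup>2) \<le> c * (norm (P *v x))\<^sup>2"
      using assms by (intro mult_left_mono) auto
    also have "\<dots> \<le> (P *v x) \<bullet> (M *v (P *v x))"
      using assms(1) unfolding scaled_identity_psd_le_iff by blast
    finally show ?thesis by (simp add: mult.assoc)
  qed
  with assms(1) show ?thesis
    unfolding scaled_identity_psd_le_iff inner_congruence by (simp add: transpose_congruence)
qed

lemma congruence_psd_le_scaled_identity:
  fixes M :: "real^'n^'n" and P :: "real^'m^'n"
  assumes "M \<preceq> c *\<^sub>R mat 1" "c \<ge> 0" "\<And>x. (norm (P *v x))\<^sup>2 \<le> b * (norm x)\<^sup>2"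
  shows "transpose P ** M ** P \<preceq> (c * b) *\<^sub>R mat 1"
proof -
  have "(P *v x) \<bullet> (M *v (P *v x)) \<le> (c * b) * (norm x)\<^sup>2" for x
  proof -
    have "(P *v x) \<bullet> (M *v (P *v x)) \<le> c * (norm (P *v x))\<^sup>2"
      using assms(1) unfolding psd_le_scaled_identity_iff by blast
    also have "\<dots> \<le> c * (b * (norm x)\<^sup>2)"
      using assms by (intro mult_left_mono) auto
    finally show ?thesis by (simp add: mult.assoc)
  qed
  with assms(1) show ?thesis
    unfolding psd_le_scaled_identity_iff inner_congruence by (simp add: transpose_congruence)
qed

section \<open>Equivalence of observability and dual controllability\<close>

theorem theorem3p1:
  fixes A :: "real \<Rightarrow> real^'n^'n" and C :: "real \<Rightarrow> real^'n^'m"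
  assumes "measurable_locally_bounded A"
    and "measurable_locally_bounded C"
    and "nonuniform_bounded_growth A"
  shows "NUCO A C \<longleftrightarrow> NUCC (\<lambda>t. - transpose (A t)) (\<lambda>t. transpose (C t))"
proof
  note A = assms(1)
  let ?\<Phi> = "transition_matrix A" and ?M = "observability_gramian A C"
  let ?W = "controllability_gramian (\<lambda>t. - transpose (A t)) (\<lambda>t. transpose (C t))"
  let ?K = "transported_gramian (\<lambda>t. - transpose (A t)) (\<lambda>t. transpose (C t))"
  assume "NUCO A C"
  then obtain n0 n1 \<theta>0 \<theta>1 where n: "n0 \<ge> 0" "n1 \<ge> 0"
    and \<theta>: "\<And>\<sigma>. \<sigma> \<ge> 0 \<Longrightarrow> \<theta>0 \<sigma> > 0 \<and> \<theta>1 \<sigma> > 0"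
    and M: "\<And>t. t \<ge> 0 \<Longrightarrow> \<exists>\<sigma>0>0. \<forall>\<sigma>\<ge>\<sigma>0.
        (\<theta>0 \<sigma> * exp (- 2 * n0 * t)) *\<^sub>R mat 1 \<preceq> ?M t (t + \<sigma>) \<and>
        ?M t (t + \<sigma>) \<preceq> (\<theta>1 \<sigma> * exp (2 * n1 * t)) *\<^sub>R mat 1"
    unfolding NUCO_def by blast
  obtain k a e where k: "k > 0" and ae: "a > 0" "e > 0"
    and growth: "\<And>t \<tau>. t \<ge> 0 \<Longrightarrow> \<tau> \<ge> 0 \<Longrightarrow>
        onorm (\<lambda>x. ?\<Phi> t \<tau> *v x) \<le> k * exp (e * \<tau>) * exp (a * \<bar>t - \<tau>\<bar>)"
    using assms(3) unfolding nonuniform_bounded_growth_def by blast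
  have \<Phi>: "norm (?\<Phi> t \<tau> *v x) \<le> k * exp (e * \<tau>) * exp (a * \<bar>t - \<tau>\<bar>) * norm x"
    if "t \<ge> 0" "\<tau> \<ge> 0" for t \<tau> x
    using onorm[OF matrix_vector_mul_bounded_linear, of "?\<Phi> t \<tau>" x] growth[OF that]
    by (meson mult_right_mono norm_ge_zero order_trans)
  \<comment> \<open>Here the growth bound starts at time \<open>t + \<sigma>\<close>, so its factor
    \<open>exp (e * (t + \<sigma>))\<close> contributes \<open>e\<close> to the rate in
    \<open>\<sigma>\<close> as well.\<close>
  have upper: "(norm (?\<Phi> t (t + \<sigma>) *v x))\<^sup>2
      \<le> k\<^sup>2 * exp (2 * e * t) * exp (2 * (e + a) * \<sigma>) * (norm x)\<^sup>2"
    if "t \<ge> 0" "\<sigma> \<ge> 0" for t \<sigma> x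
  proof -
    have "(norm (?\<Phi> t (t + \<sigma>) *v x))\<^sup>2 \<le> (k * exp (e * (t + \<sigma>)) * exp (a * \<sigma>) * norm x)\<^sup>2"
      using \<Phi>[of t "t + \<sigma>" x] that by (intro power_mono) auto
    also have "\<dots> = k\<^sup>2 * exp (2 * e * t) * exp (2 * (e + a) * \<sigma>) * (norm x)\<^sup>2"
      by (simp add: power_mult_distrib exp_double[symmetric] flip: exp_add)
        (simp add: algebra_simps flip: exp_add)
    finally show ?thesis .
  qed
  \<comment> \<open>An upper bound on the inverse \<open>?\<Phi> (t + \<sigma>) t\<close> bounds the
    matrix from below. The growth bound now starts at \<open>t\<close>, so the rate in
    \<open>\<sigma>\<close> is \<open>a\<close> alone.\<close>
  have lower: "exp (- 2 * e * t) * (exp (- 2 * a * \<sigma>) / k\<^sup>2) * (norm x)\<^sup>2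
      \<le> (norm (?\<Phi> t (t + \<sigma>) *v x))\<^sup>2"
    if "t \<ge> 0" "\<sigma> \<ge> 0" for t \<sigma> x
  proof -
    have "x = ?\<Phi> (t + \<sigma>) t *v (?\<Phi> t (t + \<sigma>) *v x)"
      using transition_matrix_inverse[OF A, of "t + \<sigma>" t] that by (simp add: matrix_vector_mul_assoc del: transpose_matrix_vector)
    then have "norm x \<le> k * exp (e * t) * exp (a * \<sigma>) * norm (?\<Phi> t (t + \<sigma>) *v x)"
      using \<Phi>[of "t + \<sigma>" t "?\<Phi> t (t + \<sigma>) *v x"] that by simp
    then have "(norm x)\<^sup>2 \<le> (k * exp (e * t) * exp (a * \<sigma>) * norm (?\<Phi> t (t + \<sigma>) *v x))\<^sup>2"
      by (intro power_mono) auto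
    also have "\<dots> = k\<^sup>2 * exp (2 * e * t) * exp (2 * a * \<sigma>) * (norm (?\<Phi> t (t + \<sigma>) *v x))\<^sup>2"
      by (simp add: power_mult_distrib exp_double[symmetric] mult.assoc)
    finally show ?thesis using k by (simp add: exp_minus field_simps)
  qed
  have W: "?W t (t + \<sigma>) = ?M t (t + \<sigma>)" if "t \<ge> 0" for t \<sigma>
    using controllability_gramian_dual[OF A that] .
  have K: "?K t (t + \<sigma>) = transpose (?\<Phi> t (t + \<sigma>)) ** ?M t (t + \<sigma>) ** ?\<Phi> t (t + \<sigma>)"
    if "t \<ge> 0" "\<sigma> \<ge> 0" for t \<sigma>
    using transported_gramian_dual[OF A, of t "t + \<sigma>"] that by simp
  \<comment> \<open>\<open>b0\<close> and \<open>b1\<close> collect the factors depending only on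
    \<open>\<sigma>\<close>. The remaining factors \<open>exp (- 2 * e * t)\<close> and
    \<open>exp (2 * e * t)\<close> turn the exponents \<open>n0\<close> and \<open>n1\<close> into
    \<open>n0 + e\<close> and \<open>n1 + e\<close>.\<close>
  define b0 where "b0 \<sigma> = \<theta>0 \<sigma> * (exp (- 2 * a * \<sigma>) / k\<^sup>2)" for \<sigma>
  define b1 where "b1 \<sigma> = \<theta>1 \<sigma> * (k\<^sup>2 * exp (2 * (e + a) * \<sigma>))" for \<sigma>
  have main: "\<exists>\<sigma>0>0. \<forall>\<sigma>\<ge>\<sigma>0.
      (exp (- 2 * n0 * t) * \<theta>0 \<sigma>) *\<^sub>R mat 1 \<preceq> ?W t (t + \<sigma>) \<and>
      ?W t (t + \<sigma>) \<preceq> (exp (2 * n1 * t) * \<theta>1 \<sigma>) *\<^sub>R mat 1 \<and>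
      (exp (- 2 * (n0 + e) * t) * b0 \<sigma>) *\<^sub>R mat 1 \<preceq> ?K t (t + \<sigma>) \<and>
      ?K t (t + \<sigma>) \<preceq> (exp (2 * (n1 + e) * t) * b1 \<sigma>) *\<^sub>R mat 1" if t: "t \<ge> 0" for t
  proof -
    obtain \<sigma>0 where \<sigma>0: "\<sigma>0 > 0" "\<And>\<sigma>. \<sigma> \<ge> \<sigma>0 \<Longrightarrow>
        (\<theta>0 \<sigma> * exp (- 2 * n0 * t)) *\<^sub>R mat 1 \<preceq> ?M t (t + \<sigma>) \<and>
        ?M t (t + \<sigma>) \<preceq> (\<theta>1 \<sigma> * exp (2 * n1 * t)) *\<^sub>R mat 1"
      using M[OF t] by blast
    have "(exp (- 2 * (n0 + e) * t) * b0 \<sigma>) *\<^sub>R mat 1 \<preceq> ?K t (t + \<sigma>) \<and>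
        ?K t (t + \<sigma>) \<preceq> (exp (2 * (n1 + e) * t) * b1 \<sigma>) *\<^sub>R mat 1" if "\<sigma> \<ge> \<sigma>0" for \<sigma>
    proof -
      have \<sigma>: "\<sigma> \<ge> 0" using that \<sigma>0(1) by simp
      have c: "0 \<le> \<theta>0 \<sigma> * exp (- 2 * n0 * t)" "0 \<le> \<theta>1 \<sigma> * exp (2 * n1 * t)"
        using \<theta>[OF \<sigma>] by auto
      have e0: "exp (- 2 * (n0 + e) * t) * b0 \<sigma>
          = (\<theta>0 \<sigma> * exp (- 2 * n0 * t)) * (exp (- 2 * e * t) * (exp (- 2 * a * \<sigma>) / k\<^sup>2))"
        unfolding b0_def by (simp add: distrib_left distrib_right exp_diff exp_minus field_simps)
      have e1: "exp (2 * (n1 + e) * t) * b1 \<sigma>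
          = (\<theta>1 \<sigma> * exp (2 * n1 * t)) * (k\<^sup>2 * exp (2 * e * t) * exp (2 * (e + a) * \<sigma>))"
        unfolding b1_def by (simp add: algebra_simps exp_add)
      show ?thesis
        unfolding e0 e1 K[OF t \<sigma>]
        using scaled_identity_psd_le_congruence[OF _ c(1) lower[OF t \<sigma>]]
          congruence_psd_le_scaled_identity[OF _ c(2) upper[OF t \<sigma>]] \<sigma>0(2)[OF that] by blast
    qed
    then show ?thesis
      using \<sigma>0 unfolding W[OF t] by (intro exI[of _ \<sigma>0]) (simp add: mult.commute)
  qed
  show "NUCC (\<lambda>t. - transpose (A t)) (\<lambda>t. transpose (C t))"
    unfolding NUCC_def
  proof (rule exI[of _ n0], intro conjI n, rule exI[of _ n1], intro conjI n,
      rule exI[of _ "n0 + e"], intro conjI, goal_cases)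
    case 2
    show ?case
    proof (rule exI[of _ "n1 + e"], intro conjI exI)
      show "\<forall>\<sigma>\<ge>0. \<theta>0 \<sigma> > 0 \<and> b0 \<sigma> > 0 \<and> \<theta>1 \<sigma> > 0 \<and> b1 \<sigma> > 0"
        using \<theta> k by (simp add: b0_def b1_def)
    qed (use main n ae in auto)
  qed (use n ae in simp)
next
  note A = assms(1)
  assume "NUCC (\<lambda>t. - transpose (A t)) (\<lambda>t. transpose (C t))"
  then obtain m0 m1 \<alpha>0 \<alpha>1 where m: "m0 \<ge> 0" "m1 \<ge> 0"
    and \<alpha>: "\<And>\<sigma>::real. \<sigma> \<ge> 0 \<Longrightarrow> \<alpha>0 \<sigma> > 0 \<and> \<alpha>1 \<sigma> > (0::real)"
    and W: "\<And>t. t \<ge> 0 \<Longrightarrow> \<exists>\<sigma>0>0. \<forall>\<sigma>\<ge>\<sigma>0.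
        (exp (- 2 * m0 * t) * \<alpha>0 \<sigma>) *\<^sub>R mat 1
          \<preceq> controllability_gramian (\<lambda>t. - transpose (A t)) (\<lambda>t. transpose (C t)) t (t + \<sigma>) \<and>
        controllability_gramian (\<lambda>t. - transpose (A t)) (\<lambda>t. transpose (C t)) t (t + \<sigma>)
          \<preceq> (exp (2 * m1 * t) * \<alpha>1 \<sigma>) *\<^sub>R mat 1"
    unfolding NUCC_def by metis
  \<comment> \<open>The dual controllability Gramian is the observability Gramian, so the same
    constants, functions and thresholds carry over.\<close>
  have "\<forall>t\<ge>0. \<exists>\<sigma>0>0. \<forall>\<sigma>\<ge>\<sigma>0.
      (\<alpha>0 \<sigma> * exp (- 2 * m0 * t)) *\<^sub>R mat 1 \<preceq> observability_gramian A C t (t + \<sigma>) \<and>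
      observability_gramian A C t (t + \<sigma>) \<preceq> (\<alpha>1 \<sigma> * exp (2 * m1 * t)) *\<^sub>R mat 1"
    using W by (simp add: controllability_gramian_dual[OF A] mult.commute)
  then show "NUCO A C"
    unfolding NUCO_def using m \<alpha> by blast
qed

end
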